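(* Let $r\geq 1$ be an integer. (i) The meromorphic function $\zeta_r(s)$ on $\mathbb{C}$ has poles only at the points $s=1/k$ with $1\leq k\leq r$, and the pole at $s=1/k$ has order $[r/k]$, where $[x]$ denotes the integer part of $x$. (ii) For each $1\leq k\leq r$, as $s\to 1/k$ we have $$\zeta_r(s)\sim C_r(k)\,(ks-1)^{-[r/k]},$$ where $C_r(k)$ is a non-zero real constant whose sign coincides with the sign of $(-1)^{r+[r/k]}$.
   Context: For an integer $r\geq 1$ and $s\in\mathbb{C}$, $\zeta_r(s)=\zeta_r(s,s,\ldots,s)=\sum_{1\leq m_1<m_2<\cdots<m_r}(m_1m_2\cdots m_r)^{-s}$ is the Euler–Zagier $r$-fold zeta-function with all arguments equal; the series converges absolutely for $\Re s>1$, and $\zeta_r(s)$ is understood via its meromorphic continuation to $\mathbb{C}$. Here $\zeta_1=\zeta$ is the Riemann zeta-function. The notation $f(s)\sim g(s)$ means $f(s)/g(s)\to 1$. *)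

theory Defs
  imports "HOL-Complex_Analysis.Complex_Analysis"
begin

definition increasing_tuples :: "nat \<Rightarrow> nat list set" where
  "increasing_tuples r = {ms. length ms = r \<and> sorted_wrt (<) ms \<and> (\<forall>m\<in>set ms. 1 \<le> m)}"

(* For complex-valued series, has_sum amounts to absolute convergence. *)
definition euler_zagier_continuation :: "nat \<Rightarrow> (complex \<Rightarrow> complex) \<Rightarrow> bool" where
  "euler_zagier_continuation r f \<longleftrightarrow>
     f nicely_meromorphic_on UNIV \<and>
     (\<forall>s. 1 < Re s \<longrightarrow>
        ((\<lambda>ms. of_nat (prod_list ms) powr (- s)) has_sum f s) (increasing_tuples r))"

(* A meromorphic continuation is unique up to its values at isolated points;
   nicely_meromorphic_on fixes those values (0 at poles, the limit elsewhere),
   so at most one function satisfies the predicate. *)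
definition euler_zagier_zeta :: "nat \<Rightarrow> complex \<Rightarrow> complex" where
  "euler_zagier_zeta r = (THE f. euler_zagier_continuation r f)"

end

theory Submission
  imports Defs
begin

text \<open>
  Newton's identities express $r\,\zeta_r(s)$ through the power sums $\zeta(ks)$:
  $r\,\zeta_r(s) = \sum_{k=1}^{r} (-1)^{k-1} \zeta(ks)\,\zeta_{r-k}(s)$. This continues
  $\zeta_r$ meromorphically, with poles at most at the points $1/k$, $1 \le k \le r$.
  Multiplying by $(ks-1)^{[r/k]}$ and letting $s \to 1/k$ gives a recursion for $C_r(k)$ in which
  only the term with $\zeta(ks)$ and the terms with $\zeta(js)$, $j \le r \bmod k$, survive.
  Since $\zeta < 0$ on $(0,1)$, all surviving terms have the sign $(-1)^{r+[r/k]}$, so they cannot cancel.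
\<close>

section \<open>The Riemann zeta function\<close>

text \<open>Only three facts about zeta enter: (s - 1) zeta(s) is entire, equals 1 at s = 1, and is
  positive on (0, 1]. One telescoping binomial expansion yields all three.

  Why the signs agree: the term with zeta(js) carries (-1)^(j-1), a limit coming from zeta, and the
  sign (-1)^(r-j+[(r-j)/k]) of the lower coefficient. If [(r-j)/k] = [r/k], then j < k, and
  zeta(j/k) < 0 supplies the missing -1. If j = k, then (ks-1) zeta(ks) tends to +1, and the missing
  -1 comes from the integer part dropping by one. Every other term keeps a positive power of ks-1
  against a finite zeta(j/k) and vanishes.

  The recursion is run on \<open>newton_zeta\<close>, whose values at its poles are accidental; only
  punctured neighbourhoods matter until \<open>remove_sings\<close> normalises these values.\<close>

lemma gbinomial_lessThan: "(a::complex) gchoose k = (\<Prod>i<k. a - of_nat i) / fact k"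
  by (simp add: gbinomial_prod_rev atLeast0LessThan)

text \<open>Error of the binomial expansion of (n + 2)^(1 - s) about n + 1, cut off after the term
  of index \<open>K\<close>. Its decay in n decides how far to the left zeta can be
  continued.\<close>

definition binomial_remainder :: "nat \<Rightarrow> complex \<Rightarrow> nat \<Rightarrow> complex" where
  "binomial_remainder K s n = of_nat (n + 2) powr (1 - s)
     - (\<Sum>k\<le>K. ((1 - s) gchoose k) * of_nat (n + 1) powr (1 - s - of_nat k))"

text \<open>Taylor's estimate for z^(1 - s) on the segment from n + 1 to n + 2. The hypothesis makes
  x^(- Re s - K) non-increasing, so the derivative of order \<open>Suc K\<close> is largest at the
  left end.\<close>

lemma norm_binomial_remainder_le:
  assumes "0 \<le> Re s + real K"
  shows "cmod (binomial_remainder K s n)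
           \<le> cmod (\<Prod>i<Suc K. 1 - s - of_nat i) / fact K * real (n + 1) powr (- Re s - real K)"
proof -
  define a where "a = 1 - s"
  define f where "f i z = (\<Prod>j<i. a - of_nat j) * z powr (a - of_nat i)" for i :: nat and z :: complex
  define B where "B = cmod (\<Prod>i<Suc K. a - of_nat i) * real (n + 1) powr (- Re s - real K)"
  let ?w = "of_nat (n + 1) :: complex" and ?z = "of_nat (n + 2) :: complex"
  let ?S = "closed_segment ?w ?z"
  have S: "\<exists>x. u = of_real x \<and> real (n + 1) \<le> x" if u: "u \<in> ?S" for u
  proof -
    from u obtain t where t: "0 \<le> t" "t \<le> 1" "u = (1 - t) *\<^sub>R ?w + t *\<^sub>R ?z"
      by (auto simp: closed_segment_def)
    have "u = of_real (real (n + 1) + t)"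
      unfolding t(3) by (simp add: scaleR_conv_of_real algebra_simps)
    thus ?thesis using t(1) by (intro exI[of _ "real (n + 1) + t"]) auto
  qed
  have "cmod (f 0 ?z - (\<Sum>i\<le>K. f i ?w * (?z - ?w) ^ i / fact i)) \<le> B * cmod (?z - ?w) ^ Suc K / fact K"
  proof (rule complex_Taylor[where S = ?S])
    fix i u assume u: "u \<in> ?S"
    obtain x where x: "u = of_real x" "real (n + 1) \<le> x" using S[OF u] by blast
    have "u \<notin> \<real>\<^sub>\<le>\<^sub>0" using x by auto
    hence "(f i has_field_derivative f (Suc i) u) (at u)"
      unfolding f_def by (auto intro!: derivative_eq_intros simp: algebra_simps)
    thus "(f i has_field_derivative f (Suc i) u) (at u within ?S)"
      by (rule has_field_derivative_at_within)
  next
    fix u assume u: "u \<in> ?S"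
    obtain x where x: "u = of_real x" "real (n + 1) \<le> x" using S[OF u] by blast
    have "cmod (u powr (a - of_nat (Suc K))) = x powr (- Re s - real K)"
      using x by (subst norm_powr_real_powr) (auto simp: a_def)
    also have "\<dots> \<le> real (n + 1) powr (- Re s - real K)"
      using x assms by (intro powr_mono2') auto
    finally show "cmod (f (Suc K) u) \<le> B"
      unfolding f_def B_def norm_mult by (intro mult_left_mono) auto
  qed auto
  also have "f 0 ?z - (\<Sum>i\<le>K. f i ?w * (?z - ?w) ^ i / fact i) = binomial_remainder K s n"
    by (simp add: f_def binomial_remainder_def a_def gbinomial_lessThan)
  finally show ?thesis by (simp add: B_def a_def)
qed

text \<open>Near a point with Re s > 1 - K the remainders are uniformly O(n^(-1-d)) for some d > 0,
  so the series may be differentiated termwise.\<close>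

lemma holomorphic_suminf_binomial_remainder:
  "(\<lambda>s. \<Sum>n. binomial_remainder K s n) holomorphic_on {s. 1 - real K < Re s}" (is ?hol)
  and sums_binomial_remainder:
  "1 - real K < Re s \<Longrightarrow> binomial_remainder K s sums (\<Sum>n. binomial_remainder K s n)"
proof -
  let ?S = "{s. 1 - real K < Re s}"
  have op: "open ?S" by (rule open_halfspace_Re_gt)
  have der: "((\<lambda>s. binomial_remainder K s n) has_field_derivative
               deriv (\<lambda>s. binomial_remainder K s n) s) (at s)" for n s
  proof -
    have "(\<lambda>s. binomial_remainder K s n) holomorphic_on UNIV"
      unfolding binomial_remainder_def gbinomial_lessThan
      by (intro holomorphic_intros) auto
    thus ?thesis by (rule holomorphic_derivI) auto
  qed
  have dom: "\<exists>d h. 0 < d \<and> summable h \<and>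
              (\<forall>\<^sub>F n in sequentially. \<forall>y\<in>ball s d \<inter> ?S. cmod (binomial_remainder K y n) \<le> h n)"
    if s: "s \<in> ?S" for s
  proof -
    \<comment> \<open>Half of the excess Re s + K - 1: on the ball of radius d, Re y + K is still at
      least 1 + d.\<close>
    define d where "d = (Re s + real K - 1) / 2"
    have d: "0 < d" using s by (simp add: d_def)
    have "Re s + real K = 1 + 2 * d" by (simp add: d_def field_simps)
    let ?P = "\<lambda>s. \<Prod>i<Suc K. 1 - s - of_nat i :: complex"
    have "compact (?P ` cball s d)"
      by (intro compact_continuous_image continuous_intros) auto
    hence "bounded (?P ` cball s d)" by (rule compact_imp_bounded)
    then obtain M where "\<forall>v\<in>?P ` cball s d. cmod v \<le> M" unfolding bounded_iff by blast
    hence M: "cmod (?P y) \<le> M" if "y \<in> cball s d" for y using that by blast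
    define h where "h n = M / fact K * real (n + 1) powr (- (1 + d))" for n
    have "summable (\<lambda>n. real n powr (- (1 + d)))"
      using d by (subst summable_real_powr_iff) auto
    hence "summable (\<lambda>n. real (n + 1) powr (- (1 + d)))"
      by (subst summable_iff_shift)
    hence "summable h" unfolding h_def by (rule summable_mult)
    moreover have "cmod (binomial_remainder K y n) \<le> h n" if y: "y \<in> ball s d" for y n
    proof -
      have "\<bar>Re s - Re y\<bar> \<le> cmod (s - y)" using abs_Re_le_cmod[of "s - y"] by simp
      also have "\<dots> < d" using y by (simp add: dist_norm)
      finally have Re: "1 + d \<le> Re y + real K" using \<open>Re s + real K = 1 + 2 * d\<close> by linarith
      have "cmod (binomial_remainder K y n) \<le> cmod (?P y) / fact K * real (n + 1) powr (- Re y - real K)"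
        using Re d by (intro norm_binomial_remainder_le) auto
      also have "\<dots> \<le> h n"
        unfolding h_def using Re M[of y] y order_trans[OF norm_ge_zero M[of y]]
        by (intro mult_mono divide_right_mono powr_mono) auto
      finally show ?thesis .
    qed
    ultimately show ?thesis using d by (intro exI[of _ d] exI[of _ h]) auto
  qed
  have "\<exists>g g'. \<forall>s\<in>?S. ((\<lambda>n. binomial_remainder K s n) sums g s) \<and>
      ((\<lambda>n. deriv (\<lambda>s. binomial_remainder K s n) s) sums g' s) \<and> (g has_field_derivative g' s) (at s)"
    by (rule series_and_derivative_comparison_local[OF op der dom])
  then obtain g g' where g: "\<And>s. s \<in> ?S \<Longrightarrow> (\<lambda>n. binomial_remainder K s n) sums g s"
    "\<And>s. s \<in> ?S \<Longrightarrow> (g has_field_derivative g' s) (at s)"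
    by metis
  have "g holomorphic_on ?S"
    using g(2) op by (auto simp: holomorphic_on_open)
  moreover have eq: "g s = (\<Sum>n. binomial_remainder K s n)" if "s \<in> ?S" for s
    using g(1)[OF that] by (rule sums_unique)
  ultimately show ?hol by (rule holomorphic_transform) auto
  show "binomial_remainder K s sums (\<Sum>n. binomial_remainder K s n)" if "1 - real K < Re s"
    using g(1)[of s] eq[of s] that by auto
qed

definition zeta_series :: "complex \<Rightarrow> complex" where
  "zeta_series s = (\<Sum>n. of_nat (n + 1) powr (- s))"

lemma summable_zeta_series:
  assumes "1 < Re s"
  shows "summable (\<lambda>n. cmod (of_nat (n + 1) powr (- s)))"
proof -
  have "summable (\<lambda>n. real n powr (- Re s))"
    using assms by (subst summable_real_powr_iff) auto
  hence "summable (\<lambda>n. real (n + 1) powr (- Re s))"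
    by (subst summable_iff_shift)
  moreover have "cmod (of_nat (n + 1) powr (- s)) = real (n + 1) powr (- Re s)" for n
    by (subst norm_powr_real_powr) auto
  ultimately show ?thesis by simp
qed

lemma sums_zeta_series: "1 < Re s \<Longrightarrow> (\<lambda>n. of_nat (n + 1) powr (- s)) sums zeta_series s"
  unfolding zeta_series_def by (rule summable_sums[OF summable_norm_cancel[OF summable_zeta_series]])

lemma has_sum_zeta_series:
  assumes "1 < Re s"
  shows "((\<lambda>n. of_nat n powr (- s)) has_sum zeta_series s) {1..}"
proof -
  have "((\<lambda>n. of_nat (n + 1) powr (- s)) has_sum zeta_series s) UNIV"
    by (intro norm_summable_imp_has_sum summable_zeta_series sums_zeta_series assms)
  also have "?this \<longleftrightarrow> ((\<lambda>n. of_nat n powr (- s)) has_sum zeta_series s) {1..}"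
    by (rule has_sum_reindex_bij_witness[of _ "\<lambda>n. n - 1" "\<lambda>n. n + 1"]) auto
  finally show ?thesis .
qed

text \<open>
  Expand $(n+1)^{1-s}$ binomially around $n$ and sum over $n$: the left-hand side telescopes, and the
  factor $s+i-1$ of $\binom{1-s}{i+1}$ cancels the pole of $\zeta(s+i)$.
\<close>
lemma zeta_series_recurrence:
  assumes s: "1 < Re s"
  shows "(s - 1) * zeta_series s = 1 + (\<Sum>n. binomial_remainder (Suc K) s n)
    - (\<Sum>i=1..K. (\<Prod>j<i. 1 - s - of_nat j) / fact (Suc i) * ((s + of_nat i - 1) * zeta_series (s + of_nat i)))"
proof -
  define T where "T i = (\<Prod>j<i. 1 - s - of_nat j) / fact (Suc i) * ((s + of_nat i - 1) * zeta_series (s + of_nat i))" for i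
  \<comment> \<open>The powers tend to 0 because Re s > 1, so only the first one, equal to 1, is
    left.\<close>
  have tel: "(\<lambda>n. of_nat (Suc n + 1) powr (1 - s) - of_nat (n + 1) powr (1 - s)) sums (0 - of_nat (0 + 1) powr (1 - s))"
  proof (rule telescope_sums)
    have "(\<lambda>n. real n powr (1 - Re s)) \<longlonglongrightarrow> 0"
      using s by (intro tendsto_neg_powr filterlim_real_sequentially) auto
    hence "(\<lambda>n. real (n + 1) powr (1 - Re s)) \<longlonglongrightarrow> 0" by (rule LIMSEQ_ignore_initial_segment)
    moreover have "cmod (of_nat (n + 1) powr (1 - s)) = real (n + 1) powr (1 - Re s)" for n
      by (subst norm_powr_real_powr) auto
    ultimately have "(\<lambda>n. cmod (of_nat (n + 1) powr (1 - s))) \<longlonglongrightarrow> 0" by (simp only:)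
    thus "(\<lambda>n. of_nat (n + 1) powr (1 - s) :: complex) \<longlonglongrightarrow> 0"
      by (rule tendsto_norm_zero_cancel)
  qed
  have T_sums: "(\<lambda>n. ((1 - s) gchoose Suc i) * of_nat (n + 1) powr (1 - s - of_nat (Suc i))) sums (- T i)" for i
  proof -
    have "(\<lambda>n. ((1 - s) gchoose Suc i) * of_nat (n + 1) powr (- (s + of_nat i))) sums
           (((1 - s) gchoose Suc i) * zeta_series (s + of_nat i))"
      using s by (intro sums_mult sums_zeta_series) auto
    moreover have "((1 - s) gchoose Suc i) * zeta_series (s + of_nat i) = - T i"
    proof -
      have "P * (- q) / F * z = - (P / F * (q * z))" for P q F z :: complex by simp
      moreover have "1 - s - of_nat i = - (s + of_nat i - 1)" by simp
      ultimately show ?thesis unfolding T_def gbinomial_lessThan prod.lessThan_Suc by (simp only:)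
    qed
    moreover have "- (s + of_nat i) = 1 - s - of_nat (Suc i)" by simp
    ultimately show ?thesis by simp
  qed
  have "(\<lambda>n. (of_nat (Suc n + 1) powr (1 - s) - of_nat (n + 1) powr (1 - s))
      - (\<Sum>i\<le>K. ((1 - s) gchoose Suc i) * of_nat (n + 1) powr (1 - s - of_nat (Suc i))))
     sums ((0 - of_nat (0 + 1) powr (1 - s)) - (\<Sum>i\<le>K. - T i))"
    by (intro sums_diff tel sums_sum T_sums)
  also have "(\<lambda>n. (of_nat (Suc n + 1) powr (1 - s) - of_nat (n + 1) powr (1 - s))
      - (\<Sum>i\<le>K. ((1 - s) gchoose Suc i) * of_nat (n + 1) powr (1 - s - of_nat (Suc i))))
     = binomial_remainder (Suc K) s"
    unfolding binomial_remainder_def by (subst sum.atMost_Suc_shift) (simp add: algebra_simps)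
  finally have "(\<Sum>n. binomial_remainder (Suc K) s n) = (\<Sum>i\<le>K. T i) - 1"
    by (simp add: sums_iff sum_negf)
  \<comment> \<open>\<open>T 0\<close> is (s - 1) zeta(s) itself; solving for it gives the
    claim.\<close>
  also have "{..K} = insert 0 {1..K}" by auto
  finally show ?thesis unfolding T_def by simp
qed

section \<open>Continuation of (s - 1) zeta(s) to the plane\<close>

text \<open>Each use of the recurrence gains a strip of width 1: its zeta values are taken at s + i
  with i >= 1, where \<open>h\<close> is already known, and the remainders of order N + 2 are
  summable for Re s > - (N + 1).\<close>

lemma zeta_strip:
  "\<exists>h. h holomorphic_on {s. - real N < Re s} \<and> (\<forall>s. 1 < Re s \<longrightarrow> h s = (s - 1) * zeta_series s)"
proof (induction N)
  case 0
  let ?h = "\<lambda>s. 1 + (\<Sum>n. binomial_remainder 1 s n)"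
  have "?h holomorphic_on {s. - real 0 < Re s}"
    using holomorphic_suminf_binomial_remainder[of 1] by (intro holomorphic_intros) auto
  moreover have "?h s = (s - 1) * zeta_series s" if "1 < Re s" for s
    using zeta_series_recurrence[OF that, of 0] by simp
  ultimately show ?case by blast
next
  case (Suc N)
  then obtain h where h: "h holomorphic_on {s. - real N < Re s}"
    "\<And>s. 1 < Re s \<Longrightarrow> h s = (s - 1) * zeta_series s" by blast
  let ?K = "Suc N"
  let ?h = "\<lambda>s. 1 + (\<Sum>n. binomial_remainder (Suc ?K) s n)
    - (\<Sum>i=1..?K. (\<Prod>j<i. 1 - s - of_nat j) / fact (Suc i) * h (s + of_nat i))"
  have "(\<lambda>s. h (s + of_nat i)) holomorphic_on {s. - real (Suc N) < Re s}" if "1 \<le> i" for i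
  proof -
    have "h \<circ> (\<lambda>s. s + of_nat i) holomorphic_on {s. - real (Suc N) < Re s}"
      using that by (intro holomorphic_on_compose_gen[OF _ h(1)] holomorphic_intros) auto
    thus ?thesis by (simp add: o_def)
  qed
  hence "?h holomorphic_on {s. - real (Suc N) < Re s}"
    using holomorphic_suminf_binomial_remainder[of "Suc ?K"] by (intro holomorphic_intros) auto
  moreover have "?h s = (s - 1) * zeta_series s" if "1 < Re s" for s
    using zeta_series_recurrence[OF that, of ?K] that by (simp add: h(2))
  ultimately show ?case by blast
qed

text \<open>The functions on the various half-planes continue the same series, hence agree by the
  identity theorem and glue.\<close>

lemma zeta_entire:
  "\<exists>h. h holomorphic_on UNIV \<and> (\<forall>s. 1 < Re s \<longrightarrow> h s = (s - 1) * zeta_series s)"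
proof -
  let ?S = "\<lambda>N. {s. - real N < Re s}"
  obtain H where H: "\<And>N. H N holomorphic_on ?S N"
    "\<And>N s. 1 < Re s \<Longrightarrow> H N s = (s - 1) * zeta_series s"
    using zeta_strip by metis
  have eq: "H M s = H N s" if "M \<le> N" "s \<in> ?S M" for M N s
  proof (rule analytic_continuation_open[of "{s. 1 < Re s}" "?S M" "H M" "H N" s])
    show "{s. 1 < Re s} \<noteq> {}" by (auto intro: exI[of _ 2])
    show "H N holomorphic_on ?S M" by (rule holomorphic_on_subset[OF H(1)]) (use that in auto)
    show "connected (?S M)" by (intro convex_connected convex_halfspace_Re_gt)
  qed (use H that in \<open>auto simp: open_halfspace_Re_gt\<close>)
  \<comment> \<open>Index of some half-plane containing \<open>s\<close>; by \<open>eq\<close> the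
    choice does not affect the value.\<close>
  define M where "M s = nat \<lceil>\<bar>Re s\<bar>\<rceil> + 1" for s
  have M: "s \<in> ?S (M s)" for s
  proof -
    have "- Re s < real (M s)" unfolding M_def by linarith
    thus ?thesis by simp
  qed
  define h where "h s = H (M s) s" for s
  have hH: "h s = H N s" if "s \<in> ?S N" for s N
    unfolding h_def using linear[of "M s" N] eq[OF _ M[of s], of N] eq[OF _ that, of "M s"] by metis
  have "h analytic_on {s}" for s
  proof -
    have "h holomorphic_on ?S (M s)"
      by (rule holomorphic_transform[OF H(1)]) (use hH in auto)
    thus ?thesis
      using M open_halfspace_Re_gt[of "- real (M s)"] unfolding analytic_at by blast
  qed
  hence "h holomorphic_on UNIV"
    using analytic_on_analytic_at analytic_imp_holomorphic by blast
  moreover have "h s = (s - 1) * zeta_series s" if "1 < Re s" for s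
    using hH[of s 0] H(2) that by auto
  ultimately show ?thesis by blast
qed

definition zeta_numerator :: "complex \<Rightarrow> complex" where
  "zeta_numerator = (SOME h. h holomorphic_on UNIV \<and> (\<forall>s. 1 < Re s \<longrightarrow> h s = (s - 1) * zeta_series s))"

lemma holomorphic_zeta_numerator: "zeta_numerator holomorphic_on UNIV"
  and zeta_numerator_series: "1 < Re s \<Longrightarrow> zeta_numerator s = (s - 1) * zeta_series s"
  unfolding zeta_numerator_def using someI_ex[OF zeta_entire] by blast+

text \<open>The recurrence with no correction terms, carried over to Re s > 0. This explicit form
  gives access to s = 1 and to the interval (0, 1).\<close>

lemma zeta_numerator_conv_remainder:
  assumes "0 < Re s"
  shows "zeta_numerator s = 1 + (\<Sum>n. binomial_remainder 1 s n)"
proof (rule analytic_continuation_open[of "{s. 1 < Re s}" "{s. 0 < Re s}" zeta_numerator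
    "\<lambda>s. 1 + (\<Sum>n. binomial_remainder 1 s n)" s])
  show "{s. 1 < Re s} \<noteq> {}" by (auto intro: exI[of _ 2])
  show "connected {s. 0 < Re s}" by (intro convex_connected convex_halfspace_Re_gt)
  show "zeta_numerator holomorphic_on {s. 0 < Re s}"
    using holomorphic_zeta_numerator by (rule holomorphic_on_subset) auto
  show "(\<lambda>s. 1 + (\<Sum>n. binomial_remainder 1 s n)) holomorphic_on {s. 0 < Re s}"
    using holomorphic_suminf_binomial_remainder[of 1] by (intro holomorphic_intros) auto
  show "zeta_numerator z = 1 + (\<Sum>n. binomial_remainder 1 z n)" if "z \<in> {s. 1 < Re s}" for z
    using zeta_series_recurrence[of z 0] that zeta_numerator_series[of z] by simp
qed (use assms in \<open>auto simp: open_halfspace_Re_gt\<close>)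

text \<open>Equivalently, zeta has residue 1 at s = 1. Each remainder there is 1 - 1 - 0.\<close>

lemma zeta_numerator_1: "zeta_numerator 1 = 1"
proof -
  \<comment> \<open>Exponent 0 gives \<open>powr\<close> the value 1 only for a nonzero
    base.\<close>
  have "(2 + of_nat n :: complex) \<noteq> 0" "(1 + of_nat n :: complex) \<noteq> 0" for n
    using of_nat_eq_0_iff[of "2 + n", where ?'a = complex] of_nat_eq_0_iff[of "1 + n", where ?'a = complex]
    by (simp_all only: of_nat_add of_nat_numeral of_nat_1)
  hence "binomial_remainder 1 1 n = 0" for n
    by (simp add: binomial_remainder_def)
  thus ?thesis by (simp add: zeta_numerator_conv_remainder)
qed

text \<open>After division by s - 1 this is the negativity of zeta on (0, 1). The partial sums are
  bounded below by x, since mere positivity would not survive the limit.\<close>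

lemma zeta_numerator_pos:
  assumes x: "0 < x" "x \<le> 1"
  shows "\<exists>c. zeta_numerator (of_real x) = of_real c \<and> 0 < c"
proof -
  define t where "t n = real (n + 2) powr (1 - x) - real (n + 1) powr (1 - x)
                    - (1 - x) * real (n + 1) powr (- x)" for n
  have t: "binomial_remainder 1 (of_real x) n = of_real (t n)" for n
    unfolding binomial_remainder_def t_def
    by (simp add: powr_of_real[symmetric])
  have "(\<lambda>n. of_real (t n) :: complex) sums (\<Sum>n. binomial_remainder 1 (of_real x) n)"
    unfolding t[symmetric] using sums_binomial_remainder[of 1 "of_real x"] x by simp
  hence sums: "t sums Re (\<Sum>n. binomial_remainder 1 (of_real x) n)"
    and im: "Im (\<Sum>n. binomial_remainder 1 (of_real x) n) = 0"
    using sums_Re sums_Im sums_unique2[OF sums_zero] by fastforce+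
  \<comment> \<open>The partial sums are $(N+1)^{1-x} - (1-x) \sum_{n \le N} n^{-x}$; compare with $\int t^{-x}\,dt$.\<close>
  have partial: "x + real (N + 2) powr (1 - x) - real (N + 1) powr (1 - x) \<le> 1 + (\<Sum>n<Suc N. t n)" for N
  proof (induction N)
    case 0
    show ?case by (simp add: t_def)
  next
    case (Suc N)
    obtain z where z: "real (N + 1) < z" "z < real (N + 2)"
      "real (N + 2) powr (1 - x) - real (N + 1) powr (1 - x)
         = (real (N + 2) - real (N + 1)) * ((1 - x) * z powr (- x))"
    proof (rule MVT2[of "real (N + 1)" "real (N + 2)" "\<lambda>z. z powr (1 - x)" "\<lambda>z. (1 - x) * z powr (- x)", THEN exE])
      show "((\<lambda>z. z powr (1 - x)) has_real_derivative (1 - x) * u powr - x) (at u)"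
        if "real (N + 1) \<le> u" for u
        using that by (auto intro!: derivative_eq_intros)
    qed auto
    \<comment> \<open>The mean value point lies left of N + 2, so the increment kept in the
      invariant covers the term that \<open>t (Suc N)\<close> subtracts.\<close>
    have "(1 - x) * real (N + 2) powr (- x) \<le> (1 - x) * z powr (- x)"
      using z x by (intro mult_left_mono powr_mono2') auto
    thus ?case using Suc.IH z(3) by (simp add: t_def[of "Suc N"] add.commute)
  qed
  have "x \<le> 1 + (\<Sum>n<N. t n)" for N
  proof (cases N)
    case (Suc M)
    show ?thesis
      using partial[of M] powr_mono2[of "1 - x" "real (M + 1)" "real (M + 2)"] x Suc by simp
  qed (use x in auto)
  hence "x \<le> 1 + Re (\<Sum>n. binomial_remainder 1 (of_real x) n)"
    using sums unfolding sums_def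
    by (intro LIMSEQ_le_const[OF tendsto_add[OF tendsto_const]]) auto
  thus ?thesis
    using x im by (intro exI[of _ "1 + Re (\<Sum>n. binomial_remainder 1 (of_real x) n)"])
      (auto simp: zeta_numerator_conv_remainder complex_eq_iff)
qed

section \<open>Newton's identities for infinite sums\<close>

definition subsets_of_card :: "'a set \<Rightarrow> nat \<Rightarrow> 'a set set" where
  "subsets_of_card X m = {S. S \<subseteq> X \<and> finite S \<and> card S = m}"

lemma subsets_of_card_0 [simp]: "subsets_of_card X 0 = {{}}"
  by (auto simp: subsets_of_card_def)

lemma abs_summable_on_times:
  fixes f :: "'a \<Rightarrow> complex" and g :: "'b \<Rightarrow> complex"
  assumes "(\<lambda>x. norm (f x)) summable_on A" "(\<lambda>y. norm (g y)) summable_on B"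
  shows "(\<lambda>p. norm (case p of (x, y) \<Rightarrow> f x * g y)) summable_on (A \<times> B)"
  unfolding Infinite_Sum.abs_summable_on_Sigma_iff
  using assms by (auto simp: norm_mult abs_mult infsum_cmult_right' intro!: summable_on_cmult_right summable_on_cmult_left)

text \<open>Splitting off a chosen element embeds the (m+1)-subsets into pairs of an m-subset and an
  index; inserting the element again inverts this.\<close>

lemma abs_summable_on_prod_subsets_of_card:
  fixes a :: "'a \<Rightarrow> complex"
  assumes "(\<lambda>n. norm (a n)) summable_on X"
  shows "(\<lambda>S. norm (prod a S)) summable_on subsets_of_card X m"
proof (induction m)
  case 0
  show ?case by simp
next
  case (Suc m)
  let ?K = "subsets_of_card X"
  define h :: "'a set \<Rightarrow> 'a set \<times> 'a" where "h S = (S - {SOME n. n \<in> S}, SOME n. n \<in> S)" for S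
  have some: "(SOME n. n \<in> S) \<in> S" if "S \<in> ?K (Suc m)" for S
  proof -
    have "S \<noteq> {}" using that by (auto simp: subsets_of_card_def)
    thus ?thesis by (simp add: some_in_eq)
  qed
  have inj: "inj_on h (?K (Suc m))"
    by (rule inj_on_inverseI[where g = "\<lambda>(T, n). insert n T"]) (use some in \<open>auto simp: h_def\<close>)
  have img: "h ` ?K (Suc m) \<subseteq> ?K m \<times> X"
  proof (rule image_subsetI)
    fix S assume S: "S \<in> ?K (Suc m)"
    thus "h S \<in> ?K m \<times> X" using some[OF S] by (auto simp: h_def subsets_of_card_def)
  qed
  have "(\<lambda>p. norm (case p of (T, n) \<Rightarrow> prod a T * a n)) summable_on (?K m \<times> X)"
    by (rule abs_summable_on_times[OF Suc assms])
  hence "(\<lambda>p. norm (case p of (T, n) \<Rightarrow> prod a T * a n)) summable_on (h ` ?K (Suc m))"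
    by (rule summable_on_subset_banach[OF _ img])
  hence "(\<lambda>S. norm (case h S of (T, n) \<Rightarrow> prod a T * a n)) summable_on ?K (Suc m)"
    by (simp add: summable_on_reindex[OF inj] o_def)
  also have "?this \<longleftrightarrow> (\<lambda>S. norm (prod a S)) summable_on ?K (Suc m)"
  proof (rule summable_on_cong)
    fix S assume S: "S \<in> ?K (Suc m)"
    have "finite S" using S by (simp add: subsets_of_card_def)
    hence "prod a S = a (SOME n. n \<in> S) * prod a (S - {SOME n. n \<in> S})"
      using some[OF S] by (rule prod.remove)
    thus "norm (case h S of (T, n) \<Rightarrow> prod a T * a n) = norm (prod a S)"
      by (simp add: h_def mult.commute)
  qed
  finally show ?case .
qed

lemma newton_identity_infsum:
  fixes a :: "'a \<Rightarrow> complex"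
  assumes a: "(\<lambda>n. norm (a n)) summable_on X"
  defines "e \<equiv> \<lambda>m. \<Sum>\<^sub>\<infinity>S\<in>subsets_of_card X m. prod a S"
    and "p \<equiv> \<lambda>k. \<Sum>\<^sub>\<infinity>n\<in>X. a n ^ k"
  shows "of_nat (Suc m) * e (Suc m) = (\<Sum>i\<le>m. (- 1) ^ i * p (Suc i) * e (m - i))"
proof -
  let ?K = "subsets_of_card X"
  let ?f = "\<lambda>k (S, n). prod a S * a n ^ k"
  define D where "D m = (SIGMA S:?K m. X - S)" for m
  define J where "J m = (SIGMA S:?K m. S)" for m
  define B where "B k m = infsum (?f k) (D m)" for k m
  \<comment> \<open>Split \<open>p k * e m\<close> by whether the extra index lies in the subset; the alternating sum then telescopes.\<close>
  have DJ: "D m \<union> J m = ?K m \<times> X" "D m \<inter> J m = {}" for m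
    by (auto simp: D_def J_def subsets_of_card_def)
  \<comment> \<open>Each |a n| is at most the total \<open>?M\<close>, so higher powers are
    dominated by a multiple of |a n|.\<close>
  have pow: "(\<lambda>n. norm (a n ^ Suc k)) summable_on X" for k
  proof (rule Infinite_Sum.abs_summable_on_comparison_test')
    let ?M = "\<Sum>\<^sub>\<infinity>n\<in>X. norm (a n)"
    show "(\<lambda>n. ?M ^ k * norm (a n)) summable_on X"
      by (rule summable_on_cmult_right[OF a])
    show "norm (a n ^ Suc k) \<le> ?M ^ k * norm (a n)" if "n \<in> X" for n
    proof -
      have "norm (a n) \<le> ?M"
        using finite_sum_le_infsum[OF a, of "{n}"] that by simp
      hence "norm (a n) ^ k \<le> ?M ^ k" by (intro power_mono) auto
      thus ?thesis
        by (simp add: norm_power norm_mult mult.commute[of "norm (a n)"] mult_right_mono)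
    qed
  qed
  have summ: "?f (Suc k) summable_on (?K m \<times> X)" for k m
    using abs_summable_on_times[OF abs_summable_on_prod_subsets_of_card[OF a] pow]
    by (rule abs_summable_summable)
  have summD: "?f (Suc k) summable_on D m" and summJ: "?f (Suc k) summable_on J m" for k m
    by (rule summable_on_subset_banach[OF summ], use DJ in blast)+
  \<comment> \<open>Taking n out of S moves one factor a n from the product into the power.\<close>
  have reindex: "(?f k has_sum s) (J (Suc m)) \<longleftrightarrow> (?f (Suc k) has_sum s) (D m)" for k m s
  proof (rule has_sum_reindex_bij_witness[of _ "\<lambda>(S, n). (insert n S, n)" "\<lambda>(S, n). (S - {n}, n)"])
    fix q assume "q \<in> J (Suc m)"
    then obtain S n where q: "q = (S, n)" "S \<in> ?K (Suc m)" "n \<in> S" by (auto simp: J_def)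
    have "prod a S = a n * prod a (S - {n})"
      using q by (intro prod.remove) (auto simp: subsets_of_card_def)
    thus "?f (Suc k) (case q of (S, n) \<Rightarrow> (S - {n}, n)) = ?f k q"
      by (simp add: q(1))
  qed (auto simp: D_def J_def subsets_of_card_def insert_absorb)
  have mult: "p (Suc k) * e m = infsum (?f (Suc k)) (?K m \<times> X)" for k m
    using infsum_Sigma_banach[OF summ[of k m]]
    by (simp add: p_def e_def infsum_cmult_right' infsum_cmult_left' mult.commute)
  also have "infsum (?f (Suc k)) (?K m \<times> X) = B (Suc k) m + infsum (?f (Suc k)) (J m)" for k m
    unfolding B_def DJ(1)[symmetric] by (intro infsum_Un_disjoint summD summJ DJ)
  finally have split: "p (Suc k) * e m = B (Suc k) m + infsum (?f (Suc k)) (J m)" for k m .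
  have "infsum (?f k) (J (Suc m)) = B (Suc k) m" for k m
    using reindex[of k m "B (Suc k) m"] summD[of k m] unfolding B_def by (simp add: infsumI)
  note shift = this
  \<comment> \<open>Stated for all \<open>k\<close>, because each unfolding lowers the subset size
    and raises the exponent by one.\<close>
  have B_eq: "B (Suc k) m = (\<Sum>i\<le>m. (- 1) ^ i * p (Suc (k + i)) * e (m - i))" for k
  proof (induction m arbitrary: k)
    case 0
    have "J 0 = {}" by (auto simp: J_def)
    thus ?case using split[of k 0] by simp
  next
    case (Suc m)
    have "B (Suc k) (Suc m) = p (Suc k) * e (Suc m) - B (Suc (Suc k)) m"
      using split[of k "Suc m"] shift[of "Suc k" m] by simp
    also have "\<dots> = (\<Sum>i\<le>Suc m. (- 1) ^ i * p (Suc (k + i)) * e (Suc m - i))"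
      unfolding Suc.IH by (subst sum.atMost_Suc_shift) (simp add: sum_negf)
    finally show ?case .
  qed
  \<comment> \<open>With exponent 0, each subset of size \<open>Suc m\<close> is counted once per
    element. Summability on \<open>J\<close> is inherited through \<open>reindex\<close>: over all
    of \<open>X\<close> the exponent 0 gives no convergence in general.\<close>
  have "B (Suc 0) m = of_nat (Suc m) * e (Suc m)"
  proof -
    have "?f 0 summable_on J (Suc m)"
      using reindex[of 0 m "B (Suc 0) m"] summD[of 0 m] unfolding B_def
      by (auto simp: summable_on_def)
    hence "infsum (?f 0) (J (Suc m)) = (\<Sum>\<^sub>\<infinity>S\<in>?K (Suc m). \<Sum>\<^sub>\<infinity>n\<in>S. ?f 0 (S, n))"
      unfolding J_def by (rule infsum_Sigma_banach[symmetric])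
    also have "\<dots> = (\<Sum>\<^sub>\<infinity>S\<in>?K (Suc m). of_nat (Suc m) * prod a S)"
      by (rule infsum_cong) (simp add: subsets_of_card_def)
    also have "\<dots> = of_nat (Suc m) * e (Suc m)"
      unfolding e_def by (rule infsum_cmult_right')
    finally show ?thesis using shift[of 0 m] by simp
  qed
  thus ?thesis using B_eq[of 0] by simp
qed

section \<open>The Euler--Zagier zeta function\<close>

text \<open>Division by zero makes the value at s = 1 equal to 0.\<close>

definition riemann_zeta :: "complex \<Rightarrow> complex" where
  "riemann_zeta s = zeta_numerator s / (s - 1)"

fun newton_zeta :: "nat \<Rightarrow> complex \<Rightarrow> complex" where
  "newton_zeta 0 s = 1"
| "newton_zeta (Suc m) s =
     (\<Sum>i\<le>m. (- 1) ^ i * riemann_zeta (of_nat (Suc i) * s) * newton_zeta (m - i) s) / of_nat (Suc m)"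

lemma infsum_power_nat_powr:
  assumes "1 < Re s" "0 < k"
  shows "(\<Sum>\<^sub>\<infinity>n\<in>{1..}. (of_nat n powr (- s)) ^ k) = riemann_zeta (of_nat k * s)"
proof -
  have "1 * 1 \<le> real k * 1" using assms(2) by simp
  also have "real k * 1 < real k * Re s" using assms by (intro mult_strict_left_mono) auto
  finally have Re: "1 < Re (of_nat k * s)" by simp
  hence "of_nat k * s \<noteq> 1" by (metis one_complex.simps(1) less_irrefl)
  hence "riemann_zeta (of_nat k * s) = zeta_series (of_nat k * s)"
    by (simp add: riemann_zeta_def zeta_numerator_series[OF Re])
  moreover have "(of_nat n powr (- s)) ^ k = of_nat n powr (- (of_nat k * s))" if "n \<in> {1..}" for n
    using that by (auto simp: powr_def exp_of_nat_mult[symmetric] mult.assoc)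
  hence "(\<Sum>\<^sub>\<infinity>n\<in>{1..}. (of_nat n powr (- s)) ^ k) = (\<Sum>\<^sub>\<infinity>n\<in>{1..}. of_nat n powr (- (of_nat k * s)))"
    by (intro infsum_cong)
  ultimately show ?thesis using infsumI[OF has_sum_zeta_series[OF Re]] by simp
qed

lemma abs_summable_nat_powr:
  assumes "1 < Re s"
  shows "(\<lambda>n. cmod (of_nat n powr (- s))) summable_on {1..}"
proof -
  have "summable (\<lambda>n. norm (cmod (of_nat (n + 1) powr (- s))))"
    using summable_zeta_series[OF assms] by (simp only: real_norm_def abs_norm_cancel)
  hence "(\<lambda>n. cmod (of_nat (n + 1) powr (- s))) summable_on UNIV"
    by (rule norm_summable_imp_summable_on)
  also have "?this \<longleftrightarrow> (\<lambda>n. cmod (of_nat n powr (- s))) summable_on {1..}"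
    by (rule summable_on_reindex_bij_witness[of _ "\<lambda>n. n - 1" "\<lambda>n. n + 1"]) auto
  finally show ?thesis .
qed

text \<open>Both sides satisfy the same recursion, the power sums being zeta(ks).\<close>

lemma infsum_prod_eq_newton_zeta:
  assumes s: "1 < Re s"
  shows "(\<Sum>\<^sub>\<infinity>S\<in>subsets_of_card {1..} m. \<Prod>n\<in>S. of_nat n powr (- s)) = newton_zeta m s"
proof (induction m rule: less_induct)
  case (less m)
  show ?case
  proof (cases m)
    case 0
    thus ?thesis by simp
  next
    case (Suc l)
    have "of_nat (Suc l) * (\<Sum>\<^sub>\<infinity>S\<in>subsets_of_card {1..} (Suc l). \<Prod>n\<in>S. of_nat n powr (- s))
      = (\<Sum>i\<le>l. (- 1) ^ i * riemann_zeta (of_nat (Suc i) * s) * newton_zeta (l - i) s)"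
      unfolding newton_identity_infsum[OF abs_summable_nat_powr[OF s]]
      using less.IH s Suc by (intro sum.cong refl) (simp add: infsum_power_nat_powr del: of_nat_Suc power_Suc One_nat_def)
    thus ?thesis by (simp add: Suc field_simps del: of_nat_Suc)
  qed
qed

text \<open>Complex \<open>powr\<close> is multiplicative here because all bases are nonnegative
  reals.\<close>

lemma of_nat_prod_list_powr:
  "of_nat (prod_list ms) powr s = (\<Prod>m\<leftarrow>ms. of_nat m powr s :: complex)"
  by (induction ms) (simp_all add: powr_times_real)

text \<open>A strictly increasing tuple is the sorted list of its entries, so tuples correspond to
  finite subsets.\<close>

lemma has_sum_newton_zeta:
  assumes s: "1 < Re s"
  shows "((\<lambda>ms. of_nat (prod_list ms) powr (- s)) has_sum newton_zeta r s) (increasing_tuples r)"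
proof -
  let ?K = "subsets_of_card {1::nat..} r"
  have "((\<lambda>S. \<Prod>n\<in>S. of_nat n powr (- s)) has_sum newton_zeta r s) ?K"
    using has_sum_infsum[OF abs_summable_summable[OF
        abs_summable_on_prod_subsets_of_card[OF abs_summable_nat_powr[OF s], of r]]]
    by (simp add: infsum_prod_eq_newton_zeta[OF s] del: One_nat_def)
  also have "?this \<longleftrightarrow> ?thesis"
  proof (rule has_sum_reindex_bij_witness[of _ set sorted_list_of_set])
    show "of_nat (prod_list (sorted_list_of_set S)) powr (- s) = (\<Prod>n\<in>S. of_nat n powr (- s))"
      if "S \<in> ?K" for S
      using that prod.distinct_set_conv_list[of "sorted_list_of_set S" "\<lambda>n. of_nat n powr (- s)"]
      by (simp add: of_nat_prod_list_powr subsets_of_card_def)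
    show "sorted_list_of_set (set ms) = ms" if "ms \<in> increasing_tuples r" for ms
      using that by (simp add: increasing_tuples_def strict_sorted_iff sorted_list_of_set.idem_if_sorted_distinct)
    show "set ms \<in> ?K" if "ms \<in> increasing_tuples r" for ms
      using that by (auto simp: increasing_tuples_def subsets_of_card_def strict_sorted_iff distinct_card)
  qed (auto simp: increasing_tuples_def subsets_of_card_def strict_sorted_iff)
  finally show ?thesis .
qed

section \<open>Meromorphy and possible poles\<close>

lemma meromorphic_newton_zeta: "newton_zeta m meromorphic_on UNIV"
proof (induction m rule: less_induct)
  case (less m)
  have zeta: "(\<lambda>s. riemann_zeta (of_nat (Suc i) * s)) meromorphic_on UNIV" for i
  proof -
    have "(zeta_numerator \<circ> (\<lambda>s. of_nat (Suc i) * s)) holomorphic_on UNIV"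
      by (rule holomorphic_on_compose_gen[OF _ holomorphic_zeta_numerator]) (auto intro!: holomorphic_intros)
    hence "(\<lambda>s. zeta_numerator (of_nat (Suc i) * s)) meromorphic_on UNIV"
      by (intro analytic_on_imp_meromorphic_on) (simp add: analytic_on_open o_def)
    thus ?thesis unfolding riemann_zeta_def by (intro meromorphic_intros)
  qed
  show ?case
  proof (cases m)
    case 0
    have "newton_zeta 0 = (\<lambda>_. 1)" by (simp add: fun_eq_iff)
    thus ?thesis unfolding 0 by (simp add: meromorphic_on_const)
  next
    case (Suc l)
    have eq: "newton_zeta (Suc l) = (\<lambda>s. (\<Sum>i\<le>l. (- 1) ^ i * riemann_zeta (of_nat (Suc i) * s)
        * newton_zeta (l - i) s) / of_nat (Suc l))"
      by (simp add: fun_eq_iff)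
    have "newton_zeta (l - i) meromorphic_on UNIV" for i
      using less Suc by simp
    thus ?thesis unfolding Suc eq using zeta by (intro meromorphic_intros)
  qed
qed

lemma analytic_at_newton_zeta:
  assumes "\<forall>k\<in>{1..r}. s \<noteq> 1 / of_nat k"
  shows "newton_zeta r analytic_on {s}"
  using assms
proof (induction r rule: less_induct)
  case (less r)
  show ?case
  proof (cases r)
    case 0
    have "newton_zeta 0 = (\<lambda>_. 1)" by (simp add: fun_eq_iff)
    thus ?thesis unfolding 0 by simp
  next
    case (Suc l)
    have eq: "newton_zeta (Suc l) = (\<lambda>s. (\<Sum>i\<le>l. (- 1) ^ i * riemann_zeta (of_nat (Suc i) * s)
        * newton_zeta (l - i) s) / of_nat (Suc l))"
      by (simp add: fun_eq_iff)
    have "newton_zeta (l - i) analytic_on {s}" if "i \<le> l" for i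
      using less Suc by auto
    moreover have "(\<lambda>s. riemann_zeta (of_nat (Suc i) * s)) analytic_on {s}" if "i \<le> l" for i
    proof -
      have "(zeta_numerator \<circ> (\<lambda>s. of_nat (Suc i) * s)) analytic_on {s}"
        by (rule analytic_on_compose_gen[where T = UNIV])
          (auto intro!: analytic_intros simp: analytic_on_open holomorphic_zeta_numerator)
      moreover have "of_nat (Suc i) * s \<noteq> 1"
      proof
        assume "of_nat (Suc i) * s = 1"
        hence "s = 1 / of_nat (Suc i)" by (simp add: field_simps del: of_nat_Suc)
        moreover have "Suc i \<in> {1..r}" using that Suc by simp
        ultimately show False using less.prems by blast
      qed
      ultimately show ?thesis unfolding riemann_zeta_def
        by (intro analytic_intros) (auto simp: o_def)
    qed
    ultimately show ?thesis unfolding Suc eq by (intro analytic_intros) (auto simp del: of_nat_Suc)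
  qed
qed


section \<open>Leading coefficients at s = 1/k\<close>

lemma riemann_zeta_neg:
  assumes "0 < x" "x < 1"
  shows "\<exists>c<0. riemann_zeta (of_real x) = of_real c"
proof -
  obtain c where c: "zeta_numerator (of_real x) = of_real c" "0 < c"
    using zeta_numerator_pos[of x] assms by auto
  have "riemann_zeta (of_real x) = of_real (c / (x - 1))"
    by (simp add: riemann_zeta_def c)
  moreover have "c / (x - 1) < 0" using c(2) assms by (simp add: divide_pos_neg)
  ultimately show ?thesis by blast
qed

text \<open>The claim includes r < k because the recursion descends to such r; there the exponent is
  0 and the limit at 1/k has the sign (-1)^r. Writing the sign condition as positivity of a product
  makes it additive over the terms.\<close>

lemma tendsto_newton_zeta:
  assumes k: "1 \<le> k"
  shows "\<exists>C. 0 < (- 1) ^ (r + r div k) * C \<and>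
    ((\<lambda>s. (of_nat k * s - 1) ^ (r div k) * newton_zeta r s) \<longlongrightarrow> complex_of_real C) (at (1 / of_nat k))"
proof (induction r rule: less_induct)
  case (less r)
  show ?case
  proof (cases r)
    case 0
    thus ?thesis by (intro exI[of _ 1]) simp
  next
    case r: (Suc m)
    let ?F = "at (1 / of_nat k :: complex)"
    define q where "q j = j div k" for j
    define u where "u s = of_nat k * s - 1" for s :: complex
    have u0: "(u \<longlongrightarrow> 0) ?F"
      unfolding u_def using k by (auto intro!: tendsto_eq_intros)
    have unz: "eventually (\<lambda>s. u s \<noteq> 0) ?F"
      using k by (auto simp: u_def eventually_at_filter field_simps)
    \<comment> \<open>the summands of Newton's identity for \<open>r * (u s ^ q r * newton_zeta r s)\<close>\<close>
    define t where "t i s = (- 1) ^ i * (u s ^ (q r - q (m - i)) * riemann_zeta (of_nat (Suc i) * s))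
                      * (u s ^ q (m - i) * newton_zeta (m - i) s)" for i s
    have cont: "((\<lambda>s. zeta_numerator (of_nat j * s)) \<longlongrightarrow> zeta_numerator (of_real (real j / real k))) ?F" for j
    proof -
      have "isCont zeta_numerator z" for z
        using holomorphic_on_imp_continuous_on[OF holomorphic_zeta_numerator]
        by (simp add: continuous_on_eq_continuous_at)
      moreover have "((\<lambda>s. of_nat j * s) \<longlongrightarrow> complex_of_real (real j / real k)) ?F"
        by (auto intro!: tendsto_eq_intros)
      ultimately show ?thesis by (rule isCont_tendsto_compose)
    qed
    \<comment> \<open>Weak sign for every term, strict sign for the surviving ones: the sum is then
      strictly signed once one term survives.\<close>
    have "\<exists>L. (t i \<longlongrightarrow> complex_of_real L) ?F \<and> 0 \<le> (- 1) ^ (r + q r) * L \<and>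
            (q (m - i) = q r \<or> Suc i = k \<longrightarrow> 0 < (- 1) ^ (r + q r) * L)" if i: "i \<le> m" for i
    proof -
      define j where "j = m - i"
      have rj: "r = j + Suc i" using i r by (simp add: j_def)
      have "\<exists>C. 0 < (- 1) ^ (j + q j) * C \<and>
          ((\<lambda>s. u s ^ q j * newton_zeta j s) \<longlongrightarrow> complex_of_real C) ?F"
        unfolding q_def u_def by (rule less.IH) (use rj in simp)
      then obtain C where C: "0 < (- 1) ^ (j + q j) * C"
        and Clim: "((\<lambda>s. u s ^ q j * newton_zeta j s) \<longlongrightarrow> complex_of_real C) ?F"
        by blast
      have sq: "(- 1 :: real) ^ i * (- 1) ^ i = 1" by (simp flip: power_mult_distrib)
      have qle: "q j \<le> q r" using rj by (simp add: q_def div_le_mono)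
      have *: "(t i \<longlongrightarrow> complex_of_real ((- 1) ^ i * Z * C)) ?F"
        if "((\<lambda>s. u s ^ (q r - q j) * riemann_zeta (of_nat (Suc i) * s)) \<longlongrightarrow> complex_of_real Z) ?F" for Z
        using tendsto_mult[OF tendsto_mult[OF tendsto_const that] Clim, of "(- 1) ^ i"]
        unfolding t_def j_def by simp
      have witness: ?thesis
        if "((\<lambda>s. u s ^ (q r - q j) * riemann_zeta (of_nat (Suc i) * s)) \<longlongrightarrow> complex_of_real Z) ?F"
          and "0 < (- 1) ^ (r + q r) * ((- 1) ^ i * Z * C)" for Z
        using *[OF that(1)] that(2) less_imp_le[OF that(2)] by blast
      show ?thesis
      proof (cases "Suc i = k")
        case True
        have q: "q r = Suc (q j)" using k unfolding q_def rj True by (simp add: div_add_self2)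
        \<comment> \<open>The single factor \<open>u s\<close> cancels the pole of zeta(ks) and
          leaves its numerator.\<close>
        have "((\<lambda>s. zeta_numerator (of_nat k * s)) \<longlongrightarrow> complex_of_real 1) ?F"
          using cont[of k] k by (simp add: zeta_numerator_1)
        moreover have "eventually (\<lambda>s. zeta_numerator (of_nat k * s)
            = u s ^ (q r - q j) * riemann_zeta (of_nat (Suc i) * s)) ?F"
          using unz unfolding q True by eventually_elim (simp add: riemann_zeta_def u_def)
        ultimately have lim: "((\<lambda>s. u s ^ (q r - q j) * riemann_zeta (of_nat (Suc i) * s)) \<longlongrightarrow> complex_of_real 1) ?F"
          by (rule Lim_transform_eventually)
        have sgn: "(- 1) ^ (r + q r) * ((- 1) ^ i * 1 * C) = (- 1) ^ (j + q j) * C"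
        proof -
          have "r + q r = j + q j + i + 2" using q rj by simp
          hence *: "(- 1) ^ (r + q r) = (- 1) ^ (j + q j) * (- 1 :: real) ^ i" by (simp add: power_add)
          have "A * e * (e * 1 * C) = A * C" if "e * e = 1" for A e :: real
            using that by algebra
          from this[OF sq] show ?thesis unfolding * .
        qed
        show ?thesis by (rule witness[OF lim]) (unfold sgn, rule C)
      next
        case False
        let ?x = "real (Suc i) / real k"
        have "?x \<noteq> 1" using False k by (simp add: field_simps)
        hence "complex_of_real ?x - 1 \<noteq> 0" by (simp del: of_real_divide)
        moreover have "((\<lambda>s. of_nat (Suc i) * s - 1) \<longlongrightarrow> complex_of_real ?x - 1) ?F"
          by (auto intro!: tendsto_eq_intros)
        ultimately have zlim: "((\<lambda>s. riemann_zeta (of_nat (Suc i) * s)) \<longlongrightarrow> riemann_zeta (of_real ?x)) ?F"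
          unfolding riemann_zeta_def by (intro tendsto_divide cont)
        show ?thesis
        proof (cases "q j = q r")
          case True
          \<comment> \<open>Removing k or more from r would lower the quotient, so zeta is evaluated
            inside (0, 1).\<close>
          have "Suc i < k"
          proof (rule ccontr)
            assume "\<not> Suc i < k"
            hence "q (j + k) \<le> q r" unfolding rj q_def by (intro div_le_mono) simp
            thus False using True k by (simp add: q_def div_add_self2)
          qed
          then obtain c where c: "c < 0" "riemann_zeta (of_real ?x) = of_real c"
            using riemann_zeta_neg[of ?x] k by auto
          have lim: "((\<lambda>s. u s ^ (q r - q j) * riemann_zeta (of_nat (Suc i) * s)) \<longlongrightarrow> complex_of_real c) ?F"
            using zlim unfolding c True by simp
          have sgn: "(- 1) ^ (r + q r) * ((- 1) ^ i * c * C) = - c * ((- 1) ^ (j + q j) * C)"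
          proof -
            have "r + q r = j + q j + i + 1" using True rj by simp
            hence *: "(- 1) ^ (r + q r) = - ((- 1) ^ (j + q j) * (- 1 :: real) ^ i)" by (simp add: power_add)
            have "- (A * e) * (e * c * C) = - c * (A * C)" if "e * e = 1" for A e :: real
              using that by algebra
            from this[OF sq] show ?thesis unfolding * .
          qed
          show ?thesis
            by (rule witness[OF lim], unfold sgn, rule mult_pos_pos[OF _ C]) (use c(1) in simp)
        next
          case ne: False
          hence "0 < q r - q j" using qle by simp
          hence "((\<lambda>s. u s ^ (q r - q j) * riemann_zeta (of_nat (Suc i) * s)) \<longlongrightarrow> complex_of_real 0) ?F"
            using tendsto_mult[OF tendsto_power[OF u0] zlim, of "q r - q j"] by (simp add: power_0_left)
          from *[OF this] show ?thesis
            using ne False by (intro exI[of _ 0]) (auto simp: j_def)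
        qed
      qed
    qed
    then obtain L where L: "\<And>i. i \<le> m \<Longrightarrow> (t i \<longlongrightarrow> complex_of_real (L i)) ?F"
      "\<And>i. i \<le> m \<Longrightarrow> 0 \<le> (- 1) ^ (r + q r) * L i"
      "\<And>i. i \<le> m \<Longrightarrow> q (m - i) = q r \<or> Suc i = k \<Longrightarrow> 0 < (- 1) ^ (r + q r) * L i"
      by metis
    \<comment> \<open>Some term survives: that of zeta(ks) if k divides r, and otherwise that of
      zeta(s), since passing from r to r - 1 keeps the quotient.\<close>
    have "\<exists>i\<le>m. q (m - i) = q r \<or> Suc i = k"
    proof (cases "k dvd r")
      case True
      hence "k \<le> r" using r by (intro dvd_imp_le) auto
      thus ?thesis using k r by (intro exI[of _ "k - 1"]) auto
    next
      case False
      hence "q m = q r" unfolding r q_def by (simp add: div_Suc dvd_eq_mod_eq_0)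
      thus ?thesis by (intro exI[of _ 0]) auto
    qed
    then obtain i where i: "i \<le> m" "q (m - i) = q r \<or> Suc i = k" by blast
    have pos: "0 < (\<Sum>i\<le>m. (- 1) ^ (r + q r) * L i)"
      by (rule sum_pos2[of _ i]) (use i L(2,3) in auto)
    have eq: "(\<lambda>s. u s ^ q r * newton_zeta r s) = (\<lambda>s. (\<Sum>i\<le>m. t i s) / of_nat (Suc m))"
    proof
      fix s
      have "t i s = u s ^ q r * ((- 1) ^ i * riemann_zeta (of_nat (Suc i) * s) * newton_zeta (m - i) s)" for i
      proof -
        have "q (m - i) \<le> q r" unfolding q_def r by (intro div_le_mono) simp
        hence "u s ^ q r = u s ^ (q r - q (m - i)) * u s ^ q (m - i)" by (simp flip: power_add)
        thus ?thesis by (simp add: t_def)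
      qed
      thus "u s ^ q r * newton_zeta r s = (\<Sum>i\<le>m. t i s) / of_nat (Suc m)"
        by (simp add: r sum_distrib_left)
    qed
    have lim: "((\<lambda>s. (\<Sum>i\<le>m. t i s) / of_nat (Suc m)) \<longlongrightarrow> complex_of_real ((\<Sum>i\<le>m. L i) / real (Suc m))) ?F"
      unfolding of_real_divide of_real_sum of_real_of_nat_eq
      by (intro tendsto_intros L(1)) (auto simp del: of_nat_Suc)
    have "0 < (- 1) ^ (r + q r) * ((\<Sum>i\<le>m. L i) / real (Suc m))"
      using pos by (simp add: sum_distrib_left[symmetric])
    with lim[folded eq] show ?thesis unfolding q_def u_def by blast
  qed
qed

section \<open>Uniqueness of the continuation and orders of the poles\<close>

text \<open>The identity theorem spreads agreement near one point to a punctured neighbourhood of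
  every point; the normalised values do the rest.\<close>

lemma nicely_meromorphic_unique:
  assumes f: "f nicely_meromorphic_on UNIV" and g: "g nicely_meromorphic_on UNIV"
    and eq: "eventually (\<lambda>s. f s = g s) (at z0)"
  shows "f = g"
proof
  fix z
  have d: "(\<lambda>s. f s - g s) meromorphic_on UNIV"
    using f g unfolding nicely_meromorphic_on_def by (intro meromorphic_intros) auto
  have iso: "isolated_singularity_at (\<lambda>s. f s - g s) w" for w
    by (rule meromorphic_on_isolated_singularity) (rule meromorphic_on_subset[OF d], simp)
  have "eventually (\<lambda>s. remove_sings (\<lambda>s. f s - g s) s = 0) (at z0)"
    using eventually_remove_sings_eq_at[OF iso] eq by eventually_elim simp
  hence "frequently (\<lambda>s. remove_sings (\<lambda>s. f s - g s) s = 0) (at z0)"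
    by (rule eventually_frequently[rotated]) simp
  hence "remove_sings (\<lambda>s. f s - g s) w = 0" for w
    by (rule frequently_eq_meromorphic_imp_constant[OF _ remove_sings_nicely_meromorphic[OF d]]) auto
  with eventually_remove_sings_eq_at[OF iso, of z] have "eventually (\<lambda>s. f s = g s) (at z)"
    by simp
  hence "remove_sings f z = remove_sings g z"
    by (rule remove_sings_cong) simp
  \<comment> \<open>Nice meromorphy prescribes 0 at poles and the limit elsewhere, exactly what
    \<open>remove_sings\<close> assigns.\<close>
  moreover have "remove_sings h z = h z" if "h nicely_meromorphic_on UNIV" for h
    using that unfolding nicely_meromorphic_on_def by (metis UNIV_I remove_sings_at_pole remove_sings_eqI)
  ultimately show "f z = g z" using f g by simp
qed

lemma euler_zagier_zeta_eq: "euler_zagier_zeta r = remove_sings (newton_zeta r)"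
  and euler_zagier_continuation_zeta: "euler_zagier_continuation r (euler_zagier_zeta r)"
proof -
  let ?f = "remove_sings (newton_zeta r)"
  have half: "?f s = newton_zeta r s" if "1 < Re s" for s
  proof (rule remove_sings_at_analytic[OF analytic_at_newton_zeta], rule ballI, rule notI)
    fix k assume k: "k \<in> {1..r}" "s = 1 / of_nat k"
    hence "Re s = 1 / real k" by (simp add: Re_divide_of_nat)
    also have "\<dots> \<le> 1" using k by simp
    finally show False using that by simp
  qed
  have cont: "euler_zagier_continuation r ?f"
    unfolding euler_zagier_continuation_def
    using remove_sings_nicely_meromorphic[OF meromorphic_newton_zeta] has_sum_newton_zeta
    by (simp add: half)
  moreover have "g = ?f" if g: "euler_zagier_continuation r g" for g
  \<comment> \<open>The base point 2 lies in Re s > 1, where both functions are the sum of the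
    series.\<close>
  proof (rule nicely_meromorphic_unique[of _ _ 2])
    have "eventually (\<lambda>s. s \<in> {s. 1 < Re s}) (at (2 :: complex))"
      by (rule eventually_at_in_open') (auto simp: open_halfspace_Re_gt)
    thus "eventually (\<lambda>s. g s = ?f s) (at 2)"
    proof eventually_elim
      case (elim s)
      thus ?case using g cont has_sum_unique unfolding euler_zagier_continuation_def by blast
    qed
  qed (use g cont in \<open>auto simp: euler_zagier_continuation_def\<close>)
  ultimately show "euler_zagier_zeta r = ?f"
    unfolding euler_zagier_zeta_def by (intro the_equality)
  with cont show "euler_zagier_continuation r (euler_zagier_zeta r)" by simp
qed

text \<open>The removable extension \<open>g\<close> of (as - 1)^n f(s) is holomorphic and nonzero
  at 1/a; as as - 1 = a (s - 1/a), the regular factor of f is g / a^n.\<close>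

lemma zorder_eq_of_tendsto:
  assumes f: "f meromorphic_on UNIV" and c: "c \<noteq> 0" and a: "a \<noteq> 0"
    and lim: "((\<lambda>s. (a * s - 1) ^ n * f s) \<longlongrightarrow> c) (at (1 / a))"
  shows "zorder f (1 / a) = - int n"
proof -
  let ?z = "1 / a"
  define g where "g = remove_sings (\<lambda>s. (a * s - 1) ^ n * f s)"
  have "(\<lambda>s. (a * s - 1) ^ n * f s) meromorphic_on UNIV"
    using f by (intro meromorphic_intros) auto
  hence iso: "isolated_singularity_at (\<lambda>s. (a * s - 1) ^ n * f s) ?z"
    by (intro meromorphic_on_isolated_singularity) (rule meromorphic_on_subset, auto)
  have gz: "g ?z = c" unfolding g_def by (rule remove_sings_eqI[OF lim])
  have "g analytic_on {?z}" unfolding g_def by (rule remove_sings_analytic_at[OF iso lim])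
  then obtain A where A: "open A" "?z \<in> A" "g holomorphic_on A" by (auto simp: analytic_at)
  obtain B where B: "open B" "?z \<in> B" "\<And>s. s \<in> B \<Longrightarrow> s \<noteq> ?z \<Longrightarrow> g s = (a * s - 1) ^ n * f s"
    using eventually_remove_sings_eq_at[OF iso] unfolding g_def eventually_at_topological by blast
  show ?thesis
  proof (rule zorder_eqI[of "A \<inter> B" _ "\<lambda>s. g s / a ^ n"])
    show "(\<lambda>s. g s / a ^ n) holomorphic_on A \<inter> B"
      using A(3) a by (intro holomorphic_intros) (auto elim: holomorphic_on_subset)
    show "f w = g w / a ^ n * (w - ?z) powi (- int n)" if w: "w \<in> A \<inter> B" "w \<noteq> ?z" for w
    proof -
      have "a * w - 1 = a * (w - ?z)" using a by (simp add: field_simps)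
      hence "g w = a ^ n * ((w - ?z) ^ n * f w)"
        using B(3)[of w] w by (simp add: power_mult_distrib mult.assoc)
      thus ?thesis using a w by (simp add: power_int_minus field_simps)
    qed
  qed (use A B gz c a in auto)
qed

theorem theorem2:
  fixes r :: nat
  assumes "1 \<le> r"
  shows "euler_zagier_continuation r (euler_zagier_zeta r) \<and>
    {s. is_pole (euler_zagier_zeta r) s} = (\<lambda>k. 1 / of_nat k) ` {1..r} \<and>
    (\<forall>k\<in>{1..r}. zorder (euler_zagier_zeta r) (1 / of_nat k) = - int (r div k)) \<and>
    (\<forall>k\<in>{1..r}. \<exists>C::real. C \<noteq> 0 \<and> sgn C = sgn ((-1) ^ (r + r div k)) \<and>
       euler_zagier_zeta r \<sim>[at (1 / of_nat k)]
         (\<lambda>s. of_real C * (of_nat k * s - 1) powi (- int (r div k))))"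
proof -
  let ?f = "euler_zagier_zeta r"
  have mero: "?f meromorphic_on UNIV"
    using euler_zagier_continuation_zeta[of r]
    by (simp add: euler_zagier_continuation_def nicely_meromorphic_on_def)
  have iso: "isolated_singularity_at (newton_zeta r) z" for z
    by (rule meromorphic_on_isolated_singularity) (rule meromorphic_on_subset[OF meromorphic_newton_zeta], simp)
  have lim: "\<exists>C. 0 < (- 1) ^ (r + r div k) * C \<and>
      ((\<lambda>s. (of_nat k * s - 1) ^ (r div k) * ?f s) \<longlongrightarrow> complex_of_real C) (at (1 / of_nat k))"
    if "k \<in> {1..r}" for k
  proof -
    have "1 \<le> k" using that by simp
    obtain C where C: "0 < (- 1) ^ (r + r div k) * C"
      "((\<lambda>s. (of_nat k * s - 1) ^ (r div k) * newton_zeta r s) \<longlongrightarrow> complex_of_real C) (at (1 / of_nat k))"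
      using tendsto_newton_zeta[OF \<open>1 \<le> k\<close>, of r] by blast
    \<comment> \<open>Removing singularities changes nothing on a punctured neighbourhood, so the
      limit carries over.\<close>
    have "eventually (\<lambda>s. (of_nat k * s - 1) ^ (r div k) * newton_zeta r s
        = (of_nat k * s - 1) ^ (r div k) * ?f s) (at (1 / of_nat k))"
      using eventually_remove_sings_eq_at[OF iso] unfolding euler_zagier_zeta_eq
      by eventually_elim simp
    with C show ?thesis by (blast intro: Lim_transform_eventually)
  qed
  have order: "zorder ?f (1 / of_nat k) = - int (r div k)" if k: "k \<in> {1..r}" for k
  proof -
    obtain C where C: "0 < (- 1) ^ (r + r div k) * C"
      "((\<lambda>s. (of_nat k * s - 1) ^ (r div k) * ?f s) \<longlongrightarrow> complex_of_real C) (at (1 / of_nat k))"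
      using lim[OF k] by blast
    show ?thesis by (rule zorder_eq_of_tendsto[OF mero _ _ C(2)]) (use C(1) k in auto)
  qed
  have asymp: "\<exists>C::real. C \<noteq> 0 \<and> sgn C = sgn ((-1) ^ (r + r div k)) \<and>
       ?f \<sim>[at (1 / of_nat k)] (\<lambda>s. of_real C * (of_nat k * s - 1) powi (- int (r div k)))"
    if k: "k \<in> {1..r}" for k
  proof -
    obtain C where C: "0 < (- 1) ^ (r + r div k) * C"
      "((\<lambda>s. (of_nat k * s - 1) ^ (r div k) * ?f s) \<longlongrightarrow> complex_of_real C) (at (1 / of_nat k))"
      using lim[OF k] by blast
    have "sgn C = sgn ((- 1) ^ (r + r div k))"
      using C(1) by (cases "even (r + r div k)") (auto simp: sgn_if)
    moreover have "C \<noteq> 0" using C(1) by auto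
    moreover have "?f \<sim>[at (1 / of_nat k)] (\<lambda>s. of_real C * (of_nat k * s - 1) powi (- int (r div k)))"
    proof (rule asymp_equivI'_const)
      show "((\<lambda>s. ?f s / (of_nat k * s - 1) powi (- int (r div k))) \<longlongrightarrow> complex_of_real C) (at (1 / of_nat k))"
        using C(2) by (simp add: power_int_minus field_simps)
    qed (use \<open>C \<noteq> 0\<close> in simp)
    ultimately show ?thesis by blast
  qed
  have "is_pole ?f s \<longleftrightarrow> s \<in> (\<lambda>k. 1 / of_nat k) ` {1..r}" for s
  proof
    assume "is_pole ?f s"
    hence "is_pole (newton_zeta r) s"
      using is_pole_cong[OF eventually_remove_sings_eq_at[OF iso] refl] by (simp add: euler_zagier_zeta_eq)
    hence "\<not> newton_zeta r analytic_on {s}" using analytic_at_imp_no_pole by blast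
    thus "s \<in> (\<lambda>k. 1 / of_nat k) ` {1..r}" using analytic_at_newton_zeta by blast
  next
    assume "s \<in> (\<lambda>k. 1 / of_nat k) ` {1..r}"
    then obtain k where k: "k \<in> {1..r}" "s = 1 / of_nat k" by blast
    obtain C where C: "0 < (- 1) ^ (r + r div k) * C"
      "((\<lambda>s. (of_nat k * s - 1) ^ (r div k) * ?f s) \<longlongrightarrow> complex_of_real C) (at s)"
      using lim[OF k(1)] k(2) by blast
    let ?u = "\<lambda>s. (of_nat k * s - 1 :: complex) ^ (r div k)"
    \<comment> \<open>Here k <= r matters: the power tends to 0 while its product with the function
      tends to C, which is nonzero, so the quotient blows up.\<close>
    have "0 < r div k" using k by (simp add: div_greater_zero_iff)
    hence "(?u \<longlongrightarrow> 0) (at s)" using k by (auto intro!: tendsto_eq_intros)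
    moreover have nz: "eventually (\<lambda>w. ?u w \<noteq> 0) (at s)"
    proof -
      have "w = s" if "of_nat k * w = 1" for w
      proof -
        have "of_nat k * w = of_nat k * s" using that k by simp
        thus ?thesis using k by (simp only: mult_cancel_left) simp
      qed
      thus ?thesis unfolding eventually_at_filter by (intro always_eventually) auto
    qed
    ultimately have "filterlim ?u (at 0) (at s)" by (simp add: filterlim_at)
    hence "filterlim (\<lambda>s. ?u s * ?f s / ?u s) at_infinity (at s)"
      by (rule filterlim_divide_at_infinity[OF C(2)]) (use C(1) in auto)
    moreover have "eventually (\<lambda>s. ?u s * ?f s / ?u s = ?f s) (at s)"
      using nz by eventually_elim simp
    ultimately show "is_pole ?f s"
      unfolding is_pole_def by (simp cong: filterlim_cong)
  qed
  thus ?thesis using euler_zagier_continuation_zeta order asymp by blast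
qed

end
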